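(* Let $\Sigma =\overline{\mathbf{C}} \setminus \{ 0, \infty \}$, let $a \in \mathbf{C} \setminus \{ 0 \}$, and define on $\Sigma$ $$g_{1}(z)= az,\qquad g_{2}(z)= -\bar{a}z,\qquad h\,dz= \frac{dz}{z^2} .$$ Then there is a complete minimal surface $X\colon \Sigma \to \mathbf{R}^4$ whose Weierstrass data is $(g_1,g_2,h\,dz)$. In particular, this surface has finite total curvature, and both $g_{1}$ and $g_{2}$ omit the two values $0, \infty$.
   Context: $\overline{\mathbf{C}}=\mathbf{C}\cup\{\infty\}$ is the Riemann sphere and $\mathrm{i}=\sqrt{-1}$. Weierstrass data in $\mathbf{R}^4$: given meromorphic functions $g_1,g_2$ and a holomorphic differential $h\,dz$ on a Riemann surface $\Sigma$, put $$\phi_1=\tfrac12(1+g_1g_2)h\,dz,\quad \phi_2=\tfrac{\mathrm{i}}2(1-g_1g_2)h\,dz,\quad \phi_3=\tfrac12(g_1-g_2)h\,dz,\quad \phi_4=-\tfrac{\mathrm{i}}2(g_1+g_2)h\,dz .$$ The triple $(g_1,g_2,h\,dz)$ is the Weierstrass data of a minimal surface $X\colon\Sigma\to\mathbf{R}^4$ if the $\phi_i$ are holomorphic without common zeros (equivalently, the zero divisor of $h\,dz$ is the sum of the polar divisors of $g_1$ and $g_2$), $\mathrm{Re}\int_c\phi_i=0$ for $i=1,2,3,4$ and every cycle $c\in H_1(\Sigma,\mathbf{Z})$, and, up to translation, $X(z)=\mathrm{Re}\left(\int_{z_0}^z2\phi_1,\dots,\int_{z_0}^z2\phi_4\right)$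 for a fixed $z_0\in\Sigma$. Then $g=(g_1,g_2)\colon\Sigma\to\overline{\mathbf{C}}\times\overline{\mathbf{C}}$ is the Gauss map of $X$, and the induced metric is $ds^2=|h|^2(1+|g_1|^2)(1+|g_2|^2)|dz|^2$. The surface is complete if all divergent paths in $\Sigma$ have infinite length with respect to $ds^2$. The total curvature is $\int_\Sigma K\,dA$, where $K$ is the Gauss curvature and $dA$ the area element of $ds^2$; it is finite if this integral is finite. A value $\alpha\in\overline{\mathbf{C}}$ is omitted by $g_i$ if $g_i$ never attains $\alpha$ on $\Sigma$. *)

theory Defs
  imports "HOL-Complex_Analysis.Complex_Analysis"
begin

section \<open>Meromorphic functions as maps to the Riemann sphere\<close>

datatype riemann_sphere = Sphere_of complex | Sphere_infty

text \<open>The library's meromorphic functions carry an arbitrary value at poles and at removable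
  singularities; the value on the sphere is the limit there.\<close>

definition sphere_value :: "(complex \<Rightarrow> complex) \<Rightarrow> complex \<Rightarrow> riemann_sphere" where
  "sphere_value g z = (if is_pole g z then Sphere_infty else Sphere_of (remove_sings g z))"

definition omits :: "complex set \<Rightarrow> (complex \<Rightarrow> complex) \<Rightarrow> riemann_sphere \<Rightarrow> bool" where
  "omits S g \<alpha> \<longleftrightarrow> (\<forall>z\<in>S. sphere_value g z \<noteq> \<alpha>)"


section \<open>Surfaces parametrised by a plane domain\<close>

text \<open>The Riemann surface is an open connected subset of the complex plane, with its global
  coordinate \<open>z = u + \<i> v\<close>.\<close>

definition partial_u :: "(complex \<Rightarrow> 'a::real_normed_vector) \<Rightarrow> complex \<Rightarrow> 'a" where
  "partial_u f z = frechet_derivative f (at z) 1"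

definition partial_v :: "(complex \<Rightarrow> 'a::real_normed_vector) \<Rightarrow> complex \<Rightarrow> 'a" where
  "partial_v f z = frechet_derivative f (at z) \<i>"

primrec C_k_on :: "nat \<Rightarrow> complex set \<Rightarrow> (complex \<Rightarrow> 'a::real_normed_vector) \<Rightarrow> bool" where
  "C_k_on 0 S f = continuous_on S f"
| "C_k_on (Suc k) S f =
     (f differentiable_on S \<and> C_k_on k S (partial_u f) \<and> C_k_on k S (partial_v f))"

definition induced_metric ::
    "(complex \<Rightarrow> 'a::euclidean_space) \<Rightarrow> complex \<Rightarrow> complex \<Rightarrow> complex \<Rightarrow> real" where
  "induced_metric X z v w = frechet_derivative X (at z) v \<bullet> frechet_derivative X (at z) w"

definition metric_E :: "(complex \<Rightarrow> 'a::euclidean_space) \<Rightarrow> complex \<Rightarrow> real" where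
  "metric_E X z = induced_metric X z 1 1"

definition metric_F :: "(complex \<Rightarrow> 'a::euclidean_space) \<Rightarrow> complex \<Rightarrow> real" where
  "metric_F X z = induced_metric X z 1 \<i>"

definition metric_G :: "(complex \<Rightarrow> 'a::euclidean_space) \<Rightarrow> complex \<Rightarrow> real" where
  "metric_G X z = induced_metric X z \<i> \<i>"

text \<open>\<open>closest_point\<close> on the tangent plane is the orthogonal projection onto it.\<close>

definition normal_part :: "(complex \<Rightarrow> 'a::euclidean_space) \<Rightarrow> complex \<Rightarrow> 'a \<Rightarrow> 'a" where
  "normal_part X z w = w - closest_point (range (frechet_derivative X (at z))) w"

text \<open>Half the trace of the second fundamental form with respect to the induced metric.\<close>

definition mean_curvature :: "(complex \<Rightarrow> 'a::euclidean_space) \<Rightarrow> complex \<Rightarrow> 'a" where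
  "mean_curvature X z =
     (1 / (2 * (metric_E X z * metric_G X z - (metric_F X z)\<^sup>2))) *\<^sub>R
       normal_part X z
         (metric_G X z *\<^sub>R partial_u (partial_u X) z
          - (2 * metric_F X z) *\<^sub>R partial_v (partial_u X) z
          + metric_E X z *\<^sub>R partial_v (partial_v X) z)"

definition minimal_surface :: "complex set \<Rightarrow> (complex \<Rightarrow> 'a::euclidean_space) \<Rightarrow> bool" where
  "minimal_surface S X \<longleftrightarrow>
     open S \<and> connected S \<and> S \<noteq> {} \<and>
     (\<forall>k. C_k_on k S X) \<and>
     (\<forall>z\<in>S. inj (frechet_derivative X (at z))) \<and>
     (\<forall>z\<in>S. \<exists>\<mu>>0. \<forall>v w. induced_metric X z v w = \<mu> * (v \<bullet> w)) \<and>
     (\<forall>z\<in>S. mean_curvature X z = 0)"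


section \<open>Completeness\<close>

definition divergent_path :: "complex set \<Rightarrow> (real \<Rightarrow> complex) \<Rightarrow> bool" where
  "divergent_path S \<gamma> \<longleftrightarrow>
     (\<forall>b\<in>{0<..<1}. \<gamma> piecewise_C1_differentiable_on {0..b}) \<and>
     \<gamma> ` {0..<1} \<subseteq> S \<and>
     (\<forall>K. compact K \<and> K \<subseteq> S \<longrightarrow> (\<forall>\<^sub>F t in at_left 1. \<gamma> t \<notin> K))"

definition induced_length ::
    "(complex \<Rightarrow> 'a::euclidean_space) \<Rightarrow> (real \<Rightarrow> complex) \<Rightarrow> ennreal" where
  "induced_length X \<gamma> =
     (\<integral>\<^sup>+t\<in>{0..<1}. ennreal (sqrt (induced_metric X (\<gamma> t)
        (vector_derivative \<gamma> (at t)) (vector_derivative \<gamma> (at t)))) \<partial>lborel)"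

definition complete_surface :: "complex set \<Rightarrow> (complex \<Rightarrow> 'a::euclidean_space) \<Rightarrow> bool" where
  "complete_surface S X \<longleftrightarrow> (\<forall>\<gamma>. divergent_path S \<gamma> \<longrightarrow> induced_length X \<gamma> = \<infinity>)"


section \<open>Total curvature\<close>

text \<open>Brioschi's formula for the Gauss curvature of \<open>E du\<^sup>2 + 2F du dv + G dv\<^sup>2\<close>. For a
  conformal metric \<open>E = G = \<lambda>\<close>, \<open>F = 0\<close> it reads \<open>K = - \<Delta> (ln \<lambda>) / (2\<lambda>)\<close>.\<close>

definition gauss_curvature :: "(complex \<Rightarrow> 'a::euclidean_space) \<Rightarrow> complex \<Rightarrow> real" where
  "gauss_curvature X z =
     (let E = metric_E X; F = metric_F X; G = metric_G X in
      (det (vector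
         [vector [- partial_v (partial_v E) z / 2 + partial_v (partial_u F) z
                    - partial_u (partial_u G) z / 2,
                  partial_u E z / 2, partial_u F z - partial_v E z / 2],
          vector [partial_v F z - partial_u G z / 2, E z, F z],
          vector [partial_v G z / 2, F z, G z]] :: real^3^3)
       - det (vector
         [vector [0, partial_v E z / 2, partial_u G z / 2],
          vector [partial_v E z / 2, E z, F z],
          vector [partial_u G z / 2, F z, G z]] :: real^3^3))
      / (E z * G z - (F z)\<^sup>2)\<^sup>2)"

definition area_density :: "(complex \<Rightarrow> 'a::euclidean_space) \<Rightarrow> complex \<Rightarrow> real" where
  "area_density X z = sqrt (metric_E X z * metric_G X z - (metric_F X z)\<^sup>2)"

definition finite_total_curvature :: "complex set \<Rightarrow> (complex \<Rightarrow> 'a::euclidean_space) \<Rightarrow> bool" where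
  "finite_total_curvature S X \<longleftrightarrow>
     set_integrable lborel S (\<lambda>z. gauss_curvature X z * area_density X z)"


section \<open>Weierstrass data in real four-space\<close>

text \<open>The coefficients of \<open>\<phi>\<^sub>1, \<dots>, \<phi>\<^sub>4\<close> with respect to \<open>dz\<close>. A pole of \<open>g\<^sub>1\<close> or \<open>g\<^sub>2\<close> can be
  compensated by a zero of \<open>h\<close>; \<open>remove_sings\<close> gives the coefficient its correct value there.\<close>

definition weierstrass_form ::
    "(complex \<Rightarrow> complex) \<Rightarrow> (complex \<Rightarrow> complex) \<Rightarrow> (complex \<Rightarrow> complex) \<Rightarrow> 4 \<Rightarrow> complex \<Rightarrow> complex"
  where
  "weierstrass_form g1 g2 h i = remove_sings (\<lambda>z.
     (vector [1 / 2 * (1 + g1 z * g2 z) * h z,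
              \<i> / 2 * (1 - g1 z * g2 z) * h z,
              1 / 2 * (g1 z - g2 z) * h z,
              - (\<i> / 2) * (g1 z + g2 z) * h z] :: complex^4) $ i)"

text \<open>Vanishing of the real periods on \<open>H\<^sub>1(S, \<int>)\<close> is stated on piecewise smooth loops, whose
  classes generate it. On the connected open set \<open>S\<close> every point is the end of some path
  \<open>\<gamma>\<close> from \<open>z0\<close>, so the last clause determines \<open>X\<close> on \<open>S\<close> up to the translation \<open>p\<close>.\<close>

definition weierstrass_data ::
    "complex set \<Rightarrow> (complex \<Rightarrow> complex) \<Rightarrow> (complex \<Rightarrow> complex) \<Rightarrow> (complex \<Rightarrow> complex) \<Rightarrow>
     (complex \<Rightarrow> real^4) \<Rightarrow> bool" where
  "weierstrass_data S g1 g2 h X \<longleftrightarrow>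
     g1 meromorphic_on S \<and> g2 meromorphic_on S \<and> h holomorphic_on S \<and>
     (\<forall>i. weierstrass_form g1 g2 h i holomorphic_on S) \<and>
     (\<forall>z\<in>S. \<exists>i. weierstrass_form g1 g2 h i z \<noteq> 0) \<and>
     (\<forall>i c. valid_path c \<and> path_image c \<subseteq> S \<and> pathfinish c = pathstart c \<longrightarrow>
        Re (contour_integral c (weierstrass_form g1 g2 h i)) = 0) \<and>
     (\<exists>z0\<in>S. \<exists>p. \<forall>z\<in>S. \<forall>\<gamma>.
        valid_path \<gamma> \<and> path_image \<gamma> \<subseteq> S \<and> pathstart \<gamma> = z0 \<and> pathfinish \<gamma> = z \<longrightarrow>
        X z = p + (\<chi> i. Re (contour_integral \<gamma> (\<lambda>w. 2 * weierstrass_form g1 g2 h i w))))"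

end

theory Submission
  imports Defs "HOL-Probability.Sinc_Integral"
begin

text \<open>Put \<open>r = \<bar>a\<bar>\<^sup>2\<close>, so that \<open>g\<^sub>1 g\<^sub>2 = - r z\<^sup>2\<close>. With respect to \<open>dz\<close>, the forms \<open>2 \<phi>\<^sub>i\<close> have the
  coefficients
  \<open>1/z\<^sup>2 - r\<close>, \<open>\<i> (1/z\<^sup>2 + r)\<close>, \<open>2 Re a / z\<close> and \<open>2 Im a / z\<close>. The first two have single-valued
  primitives; the residues of the last two are real, so that their periods are purely imaginary.
  Hence all real periods vanish, and integration gives the surface explicitly:
  \<open>X = (Re (-1/z - r z), Re (\<i> (-1/z + r z)), 2 Re a ln \<bar>z\<bar>, 2 Im a ln \<bar>z\<bar>)\<close>.
  The formula for the logarithmic components along an arbitrary path is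
  \<open>Re_contour_integral_inverse\<close>.

  Minimality holds for every real part of a holomorphic curve whose derivative \<open>\<psi>\<close> is isotropic,
  \<open>\<Sum> \<psi>\<^sub>i\<^sup>2 = 0\<close>, and nowhere zero (\<open>minimal_surface_isotropic\<close>): isotropy makes the induced metric
  conformal, and then the mean curvature is the normal part of a multiple of the Laplacian of \<open>X\<close>,
  which is zero because the components are harmonic. The metric is \<open>\<bar>dz\<bar>\<^sup>2\<close> times half of
  \<open>\<Sum> \<bar>\<psi>\<^sub>i\<bar>\<^sup>2\<close>; here this is \<open>(1/\<bar>z\<bar>\<^sup>2 + r)\<^sup>2 \<bar>dz\<bar>\<^sup>2\<close>.

  For completeness, consider \<open>f(z) = r \<bar>z\<bar> - 1/\<bar>z\<bar>\<close>. It is proper on the punctured plane, and its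
  radial derivative \<open>r + 1/\<bar>z\<bar>\<^sup>2\<close> is exactly the factor of \<open>\<bar>dz\<bar>\<close> in the line element, so that \<open>f\<close> is
  1-Lipschitz for the metric. Along a divergent path \<open>\<bar>f\<bar>\<close> is unbounded, and the length dominates
  its variation (\<open>complete_surface_conformal\<close>).

  The metric depends on \<open>\<bar>z\<bar>\<^sup>2\<close> only, and Brioschi's formula then gives
  \<open>K dA = - 4 r (1 + r \<bar>z\<bar>\<^sup>2)\<^sup>-\<^sup>2 du dv\<close>. This density is integrable over the plane, since
  \<open>(1 + r \<bar>z\<bar>\<^sup>2)\<^sup>2 \<ge> (1 + r u\<^sup>2) (1 + r v\<^sup>2)\<close> separates the variables.

  The linear functions \<open>g\<^sub>1\<close> and \<open>g\<^sub>2\<close> have no poles in the plane, and vanish only at the puncture.\<close>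


section \<open>Calculus on open subsets of the plane\<close>

lemma has_derivative_vec_lambda:
  fixes f :: "'n::finite \<Rightarrow> complex \<Rightarrow> real"
  assumes "\<And>i. (f i has_derivative f' i) (at z)"
  shows "((\<lambda>z. \<chi> i. f i z) has_derivative (\<lambda>v. \<chi> i. f' i v)) (at z)"
  by (subst has_derivative_componentwise_within)
     (auto simp: Basis_vec_def inner_axis intro!: assms)

lemma has_derivative_cmod:
  assumes "z \<noteq> 0"
  shows "(cmod has_derivative (\<lambda>v. sgn z \<bullet> v)) (at z)"
  using GDERIV_norm[OF assms] by (simp add: gderiv_def inner_commute)

lemma vector_4:
  "(vector [w, x, y, z] :: ('a::zero)^4) $ 1 = w" "(vector [w, x, y, z] :: ('a::zero)^4) $ 2 = x"
  "(vector [w, x, y, z] :: ('a::zero)^4) $ 3 = y" "(vector [w, x, y, z] :: ('a::zero)^4) $ 4 = z"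
  unfolding vector_def by simp_all

lemma has_derivative_partials:
  assumes "(f has_derivative f') (at z)"
  shows "partial_u f z = f' 1" "partial_v f z = f' \<i>"
  using frechet_derivative_at[OF assms] by (simp_all add: partial_u_def partial_v_def)

lemma has_derivative_transform_on_open:
  assumes "open S" "z \<in> S" "\<And>w. w \<in> S \<Longrightarrow> f w = g w" "(f has_derivative f') (at z)"
  shows "(g has_derivative f') (at z)"
  using assms has_derivative_transform_within_open by blast

text \<open>The operators \<open>partial_u\<close>, \<open>partial_v\<close> are local, so formulas valid only off the puncture can be
  differentiated again there. The Frechet derivative is a choice from the set of all linear maps
  that approximate the function at \<open>z\<close>; two functions that agree near \<open>z\<close> have the same such set,
  so the choices agree even when it is empty.\<close>

lemma partial_cong_on_open:
  assumes "open S" "z \<in> S" "\<And>w. w \<in> S \<Longrightarrow> f w = g w"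
  shows "partial_u f z = partial_u g z" "partial_v f z = partial_v g z"
proof -
  have "(f has_derivative f') (at z) = (g has_derivative f') (at z)" for f'
    using has_derivative_transform_on_open[of S z f g f']
      has_derivative_transform_on_open[of S z g f f'] assms by fastforce
  then have "frechet_derivative f (at z) = frechet_derivative g (at z)"
    by (simp add: frechet_derivative_def)
  then show "partial_u f z = partial_u g z" "partial_v f z = partial_v g z"
    by (simp_all add: partial_u_def partial_v_def)
qed

lemma C_k_on_cong:
  assumes "open S" "\<And>w. w \<in> S \<Longrightarrow> f w = g w"
  shows "C_k_on k S f \<longleftrightarrow> C_k_on k S g"
  using assms(2)
proof (induction k arbitrary: f g)
  case 0
  then show ?case by (simp cong: continuous_on_cong)
next
  case (Suc k)
  have "f differentiable_on S \<longleftrightarrow> g differentiable_on S"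
    using Suc.prems has_derivative_transform[of _ S f g] has_derivative_transform[of _ S g f]
    unfolding differentiable_on_def differentiable_def by metis
  moreover have "C_k_on k S (partial_u f) \<longleftrightarrow> C_k_on k S (partial_u g)"
    using Suc.prems partial_cong_on_open(1)[OF assms(1)] by (intro Suc.IH) blast
  moreover have "C_k_on k S (partial_v f) \<longleftrightarrow> C_k_on k S (partial_v g)"
    using Suc.prems partial_cong_on_open(2)[OF assms(1)] by (intro Suc.IH) blast
  ultimately show ?case by simp
qed

lemma has_derivative_Re_holomorphic:
  fixes \<psi> :: "'n::finite \<Rightarrow> complex \<Rightarrow> complex"
  assumes "open S" "z \<in> S" "\<And>i. \<psi> i holomorphic_on S"
  shows "((\<lambda>z. \<chi> i. Re (\<psi> i z)) has_derivative (\<lambda>v. \<chi> i. Re (deriv (\<psi> i) z * v))) (at z)"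
proof (rule has_derivative_vec_lambda)
  fix i
  have "(\<psi> i has_derivative (*) (deriv (\<psi> i) z)) (at z)"
    using holomorphic_derivI[OF assms(3,1,2)] by (simp add: has_field_derivative_def)
  then show "((\<lambda>z. Re (\<psi> i z)) has_derivative (\<lambda>v. Re (deriv (\<psi> i) z * v))) (at z)"
    by (rule has_derivative_Re)
qed

text \<open>By the Cauchy-Riemann equations, both partial derivatives of \<open>Re \<psi>\<close> are again real parts of
  holomorphic functions, \<open>\<psi>'\<close> and \<open>\<i> \<psi>'\<close>, so the class is closed under differentiation.\<close>

lemma C_k_on_Re_holomorphic:
  fixes \<psi> :: "'n::finite \<Rightarrow> complex \<Rightarrow> complex"
  assumes "open S" "\<And>i. \<psi> i holomorphic_on S"
  shows "C_k_on k S (\<lambda>z. \<chi> i. Re (\<psi> i z))"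
  using assms(2)
proof (induction k arbitrary: \<psi>)
  case 0
  then have "continuous_on S (\<psi> i)" for i
    by (simp add: holomorphic_on_imp_continuous_on)
  then show ?case by (auto intro!: continuous_intros)
next
  case (Suc k)
  let ?f = "\<lambda>z. \<chi> i. Re (\<psi> i z)"
  have D: "(?f has_derivative (\<lambda>v. \<chi> i. Re (deriv (\<psi> i) z * v))) (at z)" if "z \<in> S" for z
    using has_derivative_Re_holomorphic[OF assms(1) that] Suc.prems by blast
  have "?f differentiable_on S"
    using D by (meson differentiableI differentiable_at_imp_differentiable_on)
  moreover have "C_k_on k S (partial_u ?f) = C_k_on k S (\<lambda>z. \<chi> i. Re (deriv (\<psi> i) z))"
    using has_derivative_partials(1)[OF D] by (intro C_k_on_cong assms) simp
  moreover have "C_k_on k S (partial_v ?f) = C_k_on k S (\<lambda>z. \<chi> i. Re (deriv (\<psi> i) z * \<i>))"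
    using has_derivative_partials(2)[OF D] by (intro C_k_on_cong assms) simp
  moreover have "C_k_on k S (\<lambda>z. \<chi> i. Re (deriv (\<psi> i) z))"
    using Suc.prems assms(1) by (intro Suc.IH holomorphic_deriv)
  moreover have "C_k_on k S (\<lambda>z. \<chi> i. Re (deriv (\<psi> i) z * \<i>))"
    using Suc.prems assms(1) by (intro Suc.IH holomorphic_intros)
  ultimately show ?case by simp
qed

section \<open>Real parts of isotropic holomorphic curves\<close>

text \<open>The curve itself may be multivalued, as with logarithms; only its derivative \<open>\<psi>\<close> has to
  be single-valued. So \<open>X\<close> is described by its differential \<open>Re (\<psi> dz)\<close>.\<close>

lemma induced_metric_isotropic:
  fixes \<psi> :: "'n::finite \<Rightarrow> complex \<Rightarrow> complex" and X :: "complex \<Rightarrow> real^'n"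
  assumes "(X has_derivative (\<lambda>v. \<chi> i. Re (\<psi> i z * v))) (at z)" "(\<Sum>i\<in>UNIV. (\<psi> i z)\<^sup>2) = 0"
  shows "induced_metric X z v w = (\<Sum>i\<in>UNIV. (cmod (\<psi> i z))\<^sup>2) / 2 * (v \<bullet> w)"
proof -
  \<comment> \<open>Polarisation splits the product into a bilinear part, which isotropy kills, and a Hermitian
    one.\<close>
  have pol: "Re (p * v) * Re (p * w) = Re (p\<^sup>2 * (v * w)) / 2 + (cmod p)\<^sup>2 / 2 * (v \<bullet> w)" for p
    unfolding cmod_power2 inner_complex_def by (simp add: field_simps power2_eq_square)
  have "induced_metric X z v w = (\<Sum>i\<in>UNIV. Re (\<psi> i z * v) * Re (\<psi> i z * w))"
    using frechet_derivative_at[OF assms(1), symmetric]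
    by (simp add: induced_metric_def inner_vec_def)
  also have "\<dots> = Re ((\<Sum>i\<in>UNIV. (\<psi> i z)\<^sup>2) * (v * w)) / 2
      + (\<Sum>i\<in>UNIV. (cmod (\<psi> i z))\<^sup>2) / 2 * (v \<bullet> w)"
    by (simp only: pol sum.distrib sum_distrib_right sum_divide_distrib Re_sum)
  finally show ?thesis using assms(2) by simp
qed

text \<open>For a conformal parametrisation the numerator of the mean curvature is the normal part of
  \<open>E (X\<^sub>u\<^sub>u + X\<^sub>v\<^sub>v)\<close>, and \<open>X\<^sub>u\<^sub>u = Re \<psi>' = - X\<^sub>v\<^sub>v\<close>.\<close>

lemma minimal_surface_isotropic:
  fixes \<psi> :: "'n::finite \<Rightarrow> complex \<Rightarrow> complex" and X :: "complex \<Rightarrow> real^'n"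
  assumes S: "open S" "connected S" "S \<noteq> {}"
    and holo: "\<And>i. \<psi> i holomorphic_on S"
    and DX: "\<And>z. z \<in> S \<Longrightarrow> (X has_derivative (\<lambda>v. \<chi> i. Re (\<psi> i z * v))) (at z)"
    and iso: "\<And>z. z \<in> S \<Longrightarrow> (\<Sum>i\<in>UNIV. (\<psi> i z)\<^sup>2) = 0"
    and reg: "\<And>z. z \<in> S \<Longrightarrow> \<exists>i. \<psi> i z \<noteq> 0"
  shows "minimal_surface S X"
proof -
  have metric: "induced_metric X z v w = (\<Sum>i\<in>UNIV. (cmod (\<psi> i z))\<^sup>2) / 2 * (v \<bullet> w)"
    if "z \<in> S" for z v w
    by (rule induced_metric_isotropic[where \<psi> = \<psi>, OF DX[OF that] iso[OF that]])
  have pos: "(\<Sum>i\<in>UNIV. (cmod (\<psi> i z))\<^sup>2) / 2 > 0" if "z \<in> S" for z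
    using reg[OF that] by (auto intro!: sum_pos2)
  note part = has_derivative_partials[OF DX]
  have smooth: "C_k_on k S X" for k
  proof (cases k)
    case 0
    have "X differentiable_on S"
      using DX by (meson differentiableI differentiable_at_imp_differentiable_on)
    then show ?thesis using 0 by (simp add: differentiable_imp_continuous_on)
  next
    case (Suc l)
    have "X differentiable_on S"
      using DX by (meson differentiableI differentiable_at_imp_differentiable_on)
    moreover have "C_k_on l S (partial_u X) = C_k_on l S (\<lambda>z. \<chi> i. Re (\<psi> i z))"
      using part by (intro C_k_on_cong S) simp
    moreover have "C_k_on l S (partial_v X) = C_k_on l S (\<lambda>z. \<chi> i. Re (\<psi> i z * \<i>))"
      using part by (intro C_k_on_cong S) simp
    ultimately show ?thesis
      using C_k_on_Re_holomorphic[OF S(1), of \<psi> l]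
        C_k_on_Re_holomorphic[OF S(1), of "\<lambda>i z. \<psi> i z * \<i>" l] holo Suc
      by (simp add: holomorphic_intros)
  qed
  have inj: "inj (frechet_derivative X (at z))" if "z \<in> S" for z
  proof -
    have lin: "linear (frechet_derivative X (at z))"
      using DX[OF that] by (metis frechet_derivative_at has_derivative_linear)
    show ?thesis
      unfolding linear_injective_0[OF lin]
    proof (intro allI impI)
      fix v assume "frechet_derivative X (at z) v = 0"
      then have "induced_metric X z v v = 0" by (simp add: induced_metric_def)
      then show "v = 0" using metric[OF that, of v v] pos[OF that] by auto
    qed
  qed
  have mean: "mean_curvature X z = 0" if z: "z \<in> S" for z
  proof -
    have "partial_u (partial_u X) z = partial_u (\<lambda>z. \<chi> i. Re (\<psi> i z)) z"
      using part by (intro partial_cong_on_open[OF S(1) z]) simp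
    also have "\<dots> = (\<chi> i. Re (deriv (\<psi> i) z))"
      using has_derivative_partials(1)[OF has_derivative_Re_holomorphic[OF S(1) z holo]] by simp
    finally have uu: "partial_u (partial_u X) z = (\<chi> i. Re (deriv (\<psi> i) z))" .
    have "partial_v (partial_v X) z = partial_v (\<lambda>z. \<chi> i. Re (\<psi> i z * \<i>)) z"
      using part by (intro partial_cong_on_open[OF S(1) z]) simp
    also have "\<dots> = (\<chi> i. Re (deriv (\<lambda>z. \<psi> i z * \<i>) z * \<i>))"
      using holo by (intro has_derivative_partials(2)[OF has_derivative_Re_holomorphic[OF S(1) z]])
        (auto intro!: holomorphic_intros)
    also have "\<dots> = (\<chi> i. - Re (deriv (\<psi> i) z))"
      using holomorphic_on_imp_differentiable_at[OF holo S(1) z] by (simp add: deriv_cmult_right)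
    finally have vv: "partial_v (partial_v X) z = (\<chi> i. - Re (deriv (\<psi> i) z))" .
    have FEG: "metric_F X z = 0" "metric_E X z = metric_G X z"
      by (simp_all add: metric_F_def metric_E_def metric_G_def metric[OF z])
    have "0 \<in> range (frechet_derivative X (at z))"
      using DX[OF z] by (metis frechet_derivative_at has_derivative_linear linear_0 rangeI)
    then have "normal_part X z 0 = 0" by (simp add: normal_part_def closest_point_self)
    moreover have "metric_G X z *\<^sub>R partial_u (partial_u X) z
          - (2 * metric_F X z) *\<^sub>R partial_v (partial_u X) z
          + metric_E X z *\<^sub>R partial_v (partial_v X) z = 0"
      by (simp add: FEG uu vv vec_eq_iff)
    ultimately show ?thesis by (simp only: mean_curvature_def scaleR_zero_right)
  qed
  show ?thesis
    unfolding minimal_surface_def using S smooth inj mean metric pos by blast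
qed

section \<open>Completeness from a proper function\<close>

text \<open>The hypothesis \<open>grad\<close> says that \<open>f\<close> is 1-Lipschitz for the metric \<open>\<rho>\<^sup>2 \<bar>dz\<bar>\<^sup>2\<close>. A path of finite
  length \<open>l\<close> therefore stays where \<open>\<bar>f\<bar> \<le> \<bar>f (\<gamma> 0)\<bar> + l\<close>, which lies in a compact set that a
  divergent path has to leave.\<close>

lemma complete_surface_conformal:
  fixes X :: "complex \<Rightarrow> 'a::euclidean_space" and f \<rho> :: "complex \<Rightarrow> real"
  assumes metric: "\<And>z v. z \<in> S \<Longrightarrow> induced_metric X z v v = (\<rho> z * norm v)\<^sup>2"
    and \<rho>: "continuous_on S \<rho>" "\<And>z. z \<in> S \<Longrightarrow> \<rho> z \<ge> 0"
    and f: "\<And>z. z \<in> S \<Longrightarrow> (f has_derivative f' z) (at z)"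
    and grad: "\<And>z v. z \<in> S \<Longrightarrow> \<bar>f' z v\<bar> \<le> \<rho> z * norm v"
    and proper: "\<And>n. \<exists>K. compact K \<and> K \<subseteq> S \<and> {z\<in>S. \<bar>f z\<bar> \<le> n} \<subseteq> K"
  shows "complete_surface S X"
  unfolding complete_surface_def
proof (intro allI impI)
  fix \<gamma> assume div: "divergent_path S \<gamma>"
  show "induced_length X \<gamma> = \<infinity>"
  proof (rule ccontr)
    assume "induced_length X \<gamma> \<noteq> \<infinity>"
    then obtain l where l: "induced_length X \<gamma> = ennreal l" "l \<ge> 0"
      by (cases "induced_length X \<gamma>") auto
    obtain K where K: "compact K" "K \<subseteq> S" "{z\<in>S. \<bar>f z\<bar> \<le> \<bar>f (\<gamma> 0)\<bar> + l} \<subseteq> K"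
      using proper by blast
    have in_S: "\<gamma> t \<in> S" if "0 \<le> t" "t < 1" for t
      using div that by (force simp: divergent_path_def)
    have "\<forall>\<^sub>F t in at_left 1. \<gamma> t \<notin> K"
      using div K by (auto simp: divergent_path_def)
    moreover have "\<forall>\<^sub>F t in at_left (1::real). t \<in> {0<..<1}"
      by (rule eventually_at_left_real) simp
    ultimately have "\<forall>\<^sub>F t in at_left 1. \<gamma> t \<notin> K \<and> t \<in> {0<..<1}"
      by (rule eventually_conj)
    then obtain b where b: "\<gamma> b \<notin> K" "0 < b" "b < 1"
      using eventually_happens[of _ "at_left (1::real)"] by force
    have far: "\<bar>f (\<gamma> b)\<bar> > \<bar>f (\<gamma> 0)\<bar> + l"
      using K(3) b in_S[of b] by force
    have "\<gamma> piecewise_C1_differentiable_on {0..b}"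
      using div b by (auto simp: divergent_path_def)
    then obtain T D where contg: "continuous_on {0..b} \<gamma>" and T: "finite T"
      and D: "\<And>t. t \<in> {0..b} - T \<Longrightarrow> (\<gamma> has_vector_derivative D t) (at t)"
      and contD: "continuous_on ({0..b} - T) D"
      unfolding piecewise_C1_differentiable_on_def C1_differentiable_on_def by blast
    \<comment> \<open>The speed \<open>\<sigma>\<close> and the derivative \<open>\<delta>\<close> of \<open>f\<close> along the path, set to zero at the
      corners, where the vector derivative may not exist. Continuity of \<open>\<sigma>\<close> off the corners gives
      the measurability that turns the bound on the length into integrability.\<close>
    define \<sigma> where "\<sigma> t = indicator ({0..b} - T) t *\<^sub>R (\<rho> (\<gamma> t) * norm (D t))" for t
    define \<delta> where "\<delta> t = (if t \<in> {0<..<b} - T then f' (\<gamma> t) (D t) else 0)" for t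
    have "continuous_on ({0..b} - T) (\<lambda>t. \<rho> (\<gamma> t) * norm (D t))"
    proof (intro continuous_intros contD)
      show "continuous_on ({0..b} - T) (\<lambda>t. \<rho> (\<gamma> t))"
        using b in_S
        by (intro continuous_on_compose2[OF \<rho>(1)] continuous_on_subset[OF contg]) auto
    qed
    then have meas: "\<sigma> \<in> borel_measurable borel"
      unfolding \<sigma>_def using T
      by (intro borel_measurable_continuous_on_indicator) (auto intro: borel_closed finite_imp_closed)
    have nonneg: "\<sigma> t \<ge> 0" for t
      using \<rho>(2) in_S[of t] b by (auto simp: \<sigma>_def indicator_def)
    have "(\<integral>\<^sup>+t. ennreal (\<sigma> t) \<partial>lborel) \<le> induced_length X \<gamma>"
      unfolding induced_length_def
    proof (rule nn_integral_mono)
      fix t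
      show "ennreal (\<sigma> t) \<le> ennreal (sqrt (induced_metric X (\<gamma> t)
        (vector_derivative \<gamma> (at t)) (vector_derivative \<gamma> (at t)))) * indicator {0..<1} t"
      proof (cases "t \<in> {0..b} - T")
        case True
        then have "\<gamma> t \<in> S" "t \<in> {0..<1}" using in_S b by auto
        then show ?thesis
          using True \<rho>(2)[of "\<gamma> t"] by (simp add: \<sigma>_def metric vector_derivative_at[OF D])
      qed (auto simp: \<sigma>_def)
    qed
    then have fin: "(\<integral>\<^sup>+t. ennreal (\<sigma> t) \<partial>lborel) \<le> ennreal l" using l by simp
    have int: "integrable lborel \<sigma>"
      using meas nonneg fin by (intro integrableI_nonneg) (auto simp: le_less_trans)
    have "ennreal (integral\<^sup>L lborel \<sigma>) \<le> ennreal l"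
      using fin nn_integral_eq_integral[OF int] nonneg by simp
    then have le: "integral\<^sup>L lborel \<sigma> \<le> l" using l(2) by simp
    have "(\<lambda>t. if t \<in> {0..b} then \<sigma> t else 0) = \<sigma>"
      by (auto simp: \<sigma>_def indicator_def)
    then have s: "(\<sigma> has_integral integral\<^sup>L lborel \<sigma>) {0..b}"
      using has_integral_integral_lborel[OF int] has_integral_restrict_UNIV[of "{0..b}" \<sigma>] by simp
    have d: "(\<delta> has_integral (f (\<gamma> b) - f (\<gamma> 0))) {0..b}"
    proof (rule fundamental_theorem_of_calculus_interior_strong[OF T])
      show "0 \<le> b" using b by simp
      show "continuous_on {0..b} (\<lambda>t. f (\<gamma> t))"
      proof (rule continuous_on_compose2[OF _ contg])
        show "continuous_on S f"
          using f by (meson continuous_at_imp_continuous_on has_derivative_continuous)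
        show "\<gamma> ` {0..b} \<subseteq> S" using in_S b by auto
      qed
      fix t assume t: "t \<in> {0<..<b} - T"
      then have t': "t \<in> {0..b} - T" "\<gamma> t \<in> S" using in_S b by auto
      interpret bounded_linear "f' (\<gamma> t)" using f[OF t'(2)] by (rule has_derivative_bounded_linear)
      have "((\<lambda>t. f (\<gamma> t)) has_derivative (\<lambda>x. f' (\<gamma> t) (x *\<^sub>R D t))) (at t)"
        using has_derivative_compose[OF D[OF t'(1), unfolded has_vector_derivative_def]] f[OF t'(2)]
        by blast
      then show "((\<lambda>t. f (\<gamma> t)) has_vector_derivative \<delta> t) (at t)"
        using t by (simp add: has_vector_derivative_def \<delta>_def scaleR)
    qed
    have "norm (integral {0..b} \<delta>) \<le> integral {0..b} \<sigma>"
    proof (rule Henstock_Kurzweil_Integration.integral_norm_bound_integral)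
      fix t
      show "norm (\<delta> t) \<le> \<sigma> t"
      proof (cases "t \<in> {0<..<b} - T")
        case True
        then show ?thesis using grad[of "\<gamma> t" "D t"] in_S[of t] b by (simp add: \<delta>_def \<sigma>_def)
      next
        case False
        then show ?thesis using nonneg[of t] by (simp only: \<delta>_def if_False norm_zero)
      qed
    qed (use s d in auto)
    then have "\<bar>f (\<gamma> b) - f (\<gamma> 0)\<bar> \<le> l"
      using le integral_unique[OF s] integral_unique[OF d] by simp
    then show False using far by simp
  qed
qed

section \<open>Curvature of rotationally symmetric conformal metrics\<close>

text \<open>The formula is \<open>K = - \<Delta> (ln \<mu>) / (2 \<mu>)\<close> with the Laplacian of the logarithm expanded.\<close>

lemma gauss_curvature_conformal:
  fixes X :: "complex \<Rightarrow> 'a::euclidean_space"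
  assumes "open S" "z \<in> S"
    and E: "\<And>w. w \<in> S \<Longrightarrow> metric_E X w = \<mu> w"
    and F: "\<And>w. w \<in> S \<Longrightarrow> metric_F X w = 0"
    and G: "\<And>w. w \<in> S \<Longrightarrow> metric_G X w = \<mu> w"
    and nz: "\<mu> z \<noteq> 0"
  shows "gauss_curvature X z =
    ((partial_u \<mu> z)\<^sup>2 + (partial_v \<mu> z)\<^sup>2
      - \<mu> z * (partial_u (partial_u \<mu>) z + partial_v (partial_v \<mu>) z)) / (2 * \<mu> z ^ 3)"
proof -
  note pc = partial_cong_on_open[OF assms(1)]
  have d0: "partial_u (\<lambda>_. 0 :: real) w = 0" "partial_v (\<lambda>_. 0 :: real) w = 0" for w
    by (simp_all add: has_derivative_partials[OF has_derivative_const])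
  have F1: "partial_u (metric_F X) w = 0" "partial_v (metric_F X) w = 0" if "w \<in> S" for w
    using pc[OF that, of "metric_F X" "\<lambda>_. 0"] F d0 by auto
  have F2: "partial_v (partial_u (metric_F X)) z = 0"
    using pc(2)[OF assms(2), of "partial_u (metric_F X)" "\<lambda>_. 0"] F1 d0 by auto
  have E1: "partial_u (metric_E X) w = partial_u \<mu> w" "partial_v (metric_E X) w = partial_v \<mu> w"
    "partial_u (metric_G X) w = partial_u \<mu> w" "partial_v (metric_G X) w = partial_v \<mu> w"
    if "w \<in> S" for w
    using pc[OF that, of "metric_E X" \<mu>] pc[OF that, of "metric_G X" \<mu>] E G by auto
  have E2: "partial_v (partial_v (metric_E X)) z = partial_v (partial_v \<mu>) z"
    "partial_u (partial_u (metric_G X)) z = partial_u (partial_u \<mu>) z"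
    using pc(2)[OF assms(2), of "partial_v (metric_E X)"] pc(1)[OF assms(2), of "partial_u (metric_G X)"]
      E1 by auto
  show ?thesis
    unfolding gauss_curvature_def Let_def E1[OF assms(2)] E2 F1[OF assms(2)] F2
      E[OF assms(2)] F[OF assms(2)] G[OF assms(2)] det_3 vector_3
    using nz by (simp add: field_simps power2_eq_square power3_eq_cube)
qed

text \<open>The last two equations differentiate expressions of the form that the first two produce, so
  that applying both pairs gives the second partial derivatives.\<close>

lemma partials_radial:
  assumes "(\<phi> has_real_derivative \<phi>') (at ((cmod z)\<^sup>2))"
  shows "partial_u (\<lambda>z. \<phi> ((cmod z)\<^sup>2)) z = 2 * Re z * \<phi>'"
    "partial_v (\<lambda>z. \<phi> ((cmod z)\<^sup>2)) z = 2 * Im z * \<phi>'"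
    "partial_u (\<lambda>z. 2 * Re z * \<phi> ((cmod z)\<^sup>2)) z = 2 * \<phi> ((cmod z)\<^sup>2) + 4 * (Re z)\<^sup>2 * \<phi>'"
    "partial_v (\<lambda>z. 2 * Im z * \<phi> ((cmod z)\<^sup>2)) z = 2 * \<phi> ((cmod z)\<^sup>2) + 4 * (Im z)\<^sup>2 * \<phi>'"
proof -
  have sq: "((\<lambda>z. (cmod z)\<^sup>2) has_derivative (\<lambda>v. 2 * (z \<bullet> v))) (at z)"
    unfolding power2_norm_eq_inner
    by (rule has_derivative_eq_rhs, (rule derivative_intros)+) (simp add: inner_commute)
  have D: "((\<lambda>z. \<phi> ((cmod z)\<^sup>2)) has_derivative (\<lambda>v. \<phi>' * (2 * (z \<bullet> v)))) (at z)"
    using has_derivative_compose[OF sq assms[unfolded has_field_derivative_def]] .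
  show "partial_u (\<lambda>z. \<phi> ((cmod z)\<^sup>2)) z = 2 * Re z * \<phi>'"
    "partial_v (\<lambda>z. \<phi> ((cmod z)\<^sup>2)) z = 2 * Im z * \<phi>'"
    by (simp_all add: has_derivative_partials[OF D] inner_complex_def)
  have "((\<lambda>z. 2 * Re z * \<phi> ((cmod z)\<^sup>2)) has_derivative
      (\<lambda>v. 2 * Re z * (\<phi>' * (2 * (z \<bullet> v))) + 2 * Re v * \<phi> ((cmod z)\<^sup>2))) (at z)"
    by (intro derivative_intros D)
  from has_derivative_partials(1)[OF this]
  show "partial_u (\<lambda>z. 2 * Re z * \<phi> ((cmod z)\<^sup>2)) z = 2 * \<phi> ((cmod z)\<^sup>2) + 4 * (Re z)\<^sup>2 * \<phi>'"
    by (simp add: inner_complex_def power2_eq_square)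
  have "((\<lambda>z. 2 * Im z * \<phi> ((cmod z)\<^sup>2)) has_derivative
      (\<lambda>v. 2 * Im z * (\<phi>' * (2 * (z \<bullet> v))) + 2 * Im v * \<phi> ((cmod z)\<^sup>2))) (at z)"
    by (intro derivative_intros D)
  from has_derivative_partials(2)[OF this]
  show "partial_v (\<lambda>z. 2 * Im z * \<phi> ((cmod z)\<^sup>2)) z = 2 * \<phi> ((cmod z)\<^sup>2) + 4 * (Im z)\<^sup>2 * \<phi>'"
    by (simp add: inner_complex_def power2_eq_square)
qed

text \<open>In terms of \<open>s = \<bar>z\<bar>\<^sup>2\<close>, the squared gradient of \<open>\<phi> s\<close> is \<open>4 s (\<phi>' s)\<^sup>2\<close> and its Laplacian is
  \<open>4 (\<phi>' s + s \<phi>'' s)\<close>. The conformal factor \<open>\<phi> s\<close> is also the area density.\<close>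

lemma gauss_curvature_radial:
  fixes X :: "complex \<Rightarrow> 'a::euclidean_space"
  assumes S: "open S" "z \<in> S"
    and E: "\<And>w. w \<in> S \<Longrightarrow> metric_E X w = \<phi> ((cmod w)\<^sup>2)"
    and F: "\<And>w. w \<in> S \<Longrightarrow> metric_F X w = 0"
    and G: "\<And>w. w \<in> S \<Longrightarrow> metric_G X w = \<phi> ((cmod w)\<^sup>2)"
    and D1: "\<And>w. w \<in> S \<Longrightarrow> (\<phi> has_real_derivative \<phi>' ((cmod w)\<^sup>2)) (at ((cmod w)\<^sup>2))"
    and D2: "(\<phi>' has_real_derivative \<phi>'') (at ((cmod z)\<^sup>2))"
    and pos: "\<phi> ((cmod z)\<^sup>2) > 0"
  shows "gauss_curvature X z * area_density X z =
    (let s = (cmod z)\<^sup>2 in 2 * (s * (\<phi>' s)\<^sup>2 - \<phi> s * (\<phi>' s + s * \<phi>'')) / (\<phi> s)\<^sup>2)"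
proof -
  let ?l = "\<lambda>z. \<phi> ((cmod z)\<^sup>2)" and ?s = "(cmod z)\<^sup>2"
  note p1 = partials_radial(1,2)[OF D1]
  have uu: "partial_u (partial_u ?l) z = 2 * \<phi>' ?s + 4 * (Re z)\<^sup>2 * \<phi>''"
    using partial_cong_on_open(1)[OF S p1(1)] partials_radial(3)[OF D2] by simp
  have vv: "partial_v (partial_v ?l) z = 2 * \<phi>' ?s + 4 * (Im z)\<^sup>2 * \<phi>''"
    using partial_cong_on_open(2)[OF S p1(2)] partials_radial(4)[OF D2] by simp
  have area: "area_density X z = \<phi> ?s"
    using pos by (simp add: area_density_def E F G S real_sqrt_mult_self)
  have K: "gauss_curvature X z = ((2 * Re z * \<phi>' ?s)\<^sup>2 + (2 * Im z * \<phi>' ?s)\<^sup>2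
      - \<phi> ?s * ((2 * \<phi>' ?s + 4 * (Re z)\<^sup>2 * \<phi>'') + (2 * \<phi>' ?s + 4 * (Im z)\<^sup>2 * \<phi>'')))
      / (2 * \<phi> ?s ^ 3)"
    using gauss_curvature_conformal[OF S E F G] pos by (simp add: p1[OF S(2)] uu vv)
  have s: "(2 * Re z * \<phi>' ?s)\<^sup>2 + (2 * Im z * \<phi>' ?s)\<^sup>2
      - \<phi> ?s * ((2 * \<phi>' ?s + 4 * (Re z)\<^sup>2 * \<phi>'') + (2 * \<phi>' ?s + 4 * (Im z)\<^sup>2 * \<phi>''))
      = 4 * (?s * (\<phi>' ?s)\<^sup>2 - \<phi> ?s * (\<phi>' ?s + ?s * \<phi>''))"
    using cmod_power2[of z] by algebra
  show ?thesis
    unfolding K s area Let_def using pos by (simp add: field_simps power2_eq_square power3_eq_cube)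
qed

section \<open>An integrable rational function of the modulus\<close>

lemma integrable_inverse_1_plus_cmod_square:
  assumes "r > 0"
  shows "integrable lborel (\<lambda>z. inverse ((1 + r * (cmod z)\<^sup>2)\<^sup>2))"
proof -
  define f where "f x = inverse (1 + r * x\<^sup>2)" for x :: real
  have f0: "f x \<ge> 0" for x using assms by (simp add: f_def)
  have [measurable]: "f \<in> borel_measurable borel" unfolding f_def by measurable
  have "integrable lborel (\<lambda>x::real. inverse (1 + x\<^sup>2))"
    using integrable_inverse_1_plus_square by (simp add: set_integrable_def)
  then have "integrable lborel (\<lambda>x. inverse (1 + (0 + sqrt r * x)\<^sup>2))"
    using assms by (intro lborel_integrable_real_affine) auto
  then have int: "integrable lborel f"
    using assms by (simp add: f_def[abs_def] power_mult_distrib)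
  have "(\<integral>\<^sup>+z. (\<Prod>b\<in>Basis. ennreal (f ((z::complex) \<bullet> b))) \<partial>lborel)
      = (\<Prod>b\<in>(Basis::complex set). \<integral>\<^sup>+x. ennreal (f x) \<partial>lborel)"
    using nn_integral_lborel_prod[of "\<lambda>b::complex. \<lambda>x. ennreal (f x)"] by simp
  also have "\<dots> < \<infinity>"
    using nn_integral_eq_integral[OF int] f0
    by (simp add: Basis_complex_def ennreal_mult_less_top)
  finally have fin: "(\<integral>\<^sup>+z. (\<Prod>b\<in>Basis. ennreal (f ((z::complex) \<bullet> b))) \<partial>lborel) < \<infinity>" .
  have "integrable lborel (\<lambda>z. f (Re z) * f (Im z))"
  proof (rule integrableI_nonneg)
    show "(\<integral>\<^sup>+z. ennreal (f (Re z) * f (Im z)) \<partial>lborel) < \<infinity>"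
      using fin f0 by (simp add: Basis_complex_def ennreal_mult)
  qed (use f0 in auto)
  then show ?thesis
  proof (rule Bochner_Integration.integrable_bound)
    have "inverse ((1 + r * (cmod z)\<^sup>2)\<^sup>2) \<le> f (Re z) * f (Im z)" for z
    proof -
      have "(1 + r * (Re z)\<^sup>2) * (1 + r * (Im z)\<^sup>2) \<le> (1 + r * (cmod z)\<^sup>2) * (1 + r * (cmod z)\<^sup>2)"
        using assms by (intro mult_mono) (auto simp: cmod_power2)
      moreover have "(1 + r * (Re z)\<^sup>2) * (1 + r * (Im z)\<^sup>2) > 0"
        using assms by (simp add: add_pos_nonneg)
      ultimately show ?thesis
        unfolding f_def inverse_mult_distrib[symmetric] power2_eq_square[of "1 + _"]
        by (rule le_imp_inverse_le)
    qed
    then show "AE z in lborel. norm (inverse ((1 + r * (cmod z)\<^sup>2)\<^sup>2)) \<le> norm (f (Re z) * f (Im z))"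
      using f0 by simp
  qed measurable
qed

section \<open>The logarithm along a path\<close>

text \<open>There is no single-valued logarithm around \<open>0\<close>, but the exponential of the integral is the
  quotient of the end points; taking moduli leaves the real part alone.\<close>

lemma Re_contour_integral_inverse:
  assumes "valid_path \<gamma>" "0 \<notin> path_image \<gamma>"
  shows "Re (contour_integral \<gamma> (\<lambda>w. 1 / w)) = ln (cmod (pathfinish \<gamma>)) - ln (cmod (pathstart \<gamma>))"
proof -
  have "pathstart \<gamma> \<noteq> 0" using assms(2) pathstart_in_path_image by metis
  moreover have "pathfinish \<gamma> = exp (contour_integral \<gamma> (\<lambda>w. 1 / w)) * pathstart \<gamma>"
    using winding_number_exp_2pi[OF valid_path_imp_path assms(2)] winding_number_valid_path[OF assms]
      assms(1) by simp
  ultimately show ?thesis by (simp add: norm_mult ln_mult)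
qed

lemma omits_holomorphic:
  assumes "open S" "g holomorphic_on S" "\<And>z. z \<in> S \<Longrightarrow> g z \<noteq> c"
  shows "omits S g (Sphere_of c)" "omits S g Sphere_infty"
proof -
  have "g analytic_on {z}" if "z \<in> S" for z
    using assms(1,2) that analytic_at by blast
  then show "omits S g (Sphere_of c)" "omits S g Sphere_infty"
    using assms(3) by (auto simp: omits_def sphere_value_def analytic_at_imp_no_pole)
qed

section \<open>The surface\<close>

text \<open>The coefficients of \<open>2 \<phi>\<^sub>1, \<dots>, 2 \<phi>\<^sub>4\<close>, simplified for \<open>g\<^sub>1 = a z\<close>, \<open>g\<^sub>2 = - cnj a z\<close> and
  \<open>h = 1/z\<^sup>2\<close>.\<close>

definition differential :: "complex \<Rightarrow> 4 \<Rightarrow> complex \<Rightarrow> complex" where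
  "differential a i z = (vector
     [1 / z\<^sup>2 - of_real ((cmod a)\<^sup>2), \<i> * (1 / z\<^sup>2 + of_real ((cmod a)\<^sup>2)),
      2 * of_real (Re a) / z, 2 * of_real (Im a) / z] :: complex^4) $ i"

definition surface :: "complex \<Rightarrow> complex \<Rightarrow> real^4" where
  "surface a z = vector
     [Re (- 1 / z - of_real ((cmod a)\<^sup>2) * z), Re (\<i> * (- 1 / z + of_real ((cmod a)\<^sup>2) * z)),
      2 * Re a * ln (cmod z), 2 * Im a * ln (cmod z)]"

lemma differential_holomorphic: "differential a i holomorphic_on (UNIV - {0})"
proof -
  have "\<forall>i. (\<lambda>z. differential a i z) holomorphic_on (UNIV - {0})"
    unfolding forall_4 differential_def vector_4 by (auto intro!: holomorphic_intros)
  then show ?thesis by simp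
qed

lemma differential_isotropic: "(\<Sum>i\<in>UNIV. (differential a i z)\<^sup>2) = 0"
proof -
  have "complex_of_real ((cmod a)\<^sup>2) = of_real (Re a)^2 + of_real (Im a)^2"
    by (simp add: cmod_power2)
  moreover have "(1 / z\<^sup>2 - r)\<^sup>2 + (\<i> * (1 / z\<^sup>2 + r))\<^sup>2 + (2 * x / z)\<^sup>2 + (2 * y / z)\<^sup>2
    = 4 * (x\<^sup>2 + y\<^sup>2 - r) / z\<^sup>2" for r x y :: complex
    by (cases "z = 0") (simp_all add: power_mult_distrib field_simps power2_eq_square)
  ultimately show ?thesis by (simp add: sum_4 differential_def vector_4)
qed

text \<open>The parallelogram law removes the mixed terms of the first two coefficients; the last two
  supply the cross term of the square on the right, because \<open>(Re a)\<^sup>2 + (Im a)\<^sup>2 = \<bar>a\<bar>\<^sup>2\<close>.\<close>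

lemma differential_norm:
  "(\<Sum>i\<in>UNIV. (cmod (differential a i z))\<^sup>2) / 2 = (1 / (cmod z)\<^sup>2 + (cmod a)\<^sup>2)\<^sup>2"
proof -
  let ?r = "(cmod a)\<^sup>2"
  have par: "(cmod (w - of_real r))\<^sup>2 + (cmod (w + of_real r))\<^sup>2 = 2 * (cmod w)\<^sup>2 + 2 * r\<^sup>2" for w r
    unfolding cmod_power2 by (simp add: power2_eq_square algebra_simps)
  have lin: "(cmod (2 * of_real c / z))\<^sup>2 = 4 * c\<^sup>2 / (cmod z)\<^sup>2" for c
    by (simp add: norm_mult norm_divide power_divide power_mult_distrib)
  have "(\<Sum>i\<in>UNIV. (cmod (differential a i z))\<^sup>2)
      = (cmod (1 / z\<^sup>2 - of_real ?r))\<^sup>2 + (cmod (1 / z\<^sup>2 + of_real ?r))\<^sup>2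
        + 4 * (Re a)\<^sup>2 / (cmod z)\<^sup>2 + 4 * (Im a)\<^sup>2 / (cmod z)\<^sup>2"
    unfolding sum_4 differential_def vector_4 lin by (simp add: norm_mult)
  also have "\<dots> = 2 * (1 / (cmod z)\<^sup>2)\<^sup>2 + 2 * ?r\<^sup>2 + 4 * ((Re a)\<^sup>2 + (Im a)\<^sup>2) / (cmod z)\<^sup>2"
    unfolding par by (simp add: norm_divide norm_power add_divide_distrib)
  finally show ?thesis
    unfolding cmod_power2[of a, symmetric]
    by (simp add: power2_sum field_simps)
qed

lemma surface_has_derivative:
  assumes "z \<noteq> 0"
  shows "(surface a has_derivative (\<lambda>v. \<chi> i. Re (differential a i z * v))) (at z)"
proof -
  let ?r = "complex_of_real ((cmod a)\<^sup>2)"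
  have "((\<lambda>z. - 1 / z - ?r * z) has_field_derivative (1 / z\<^sup>2 - ?r)) (at z)"
    "((\<lambda>z. \<i> * (- 1 / z + ?r * z)) has_field_derivative (\<i> * (1 / z\<^sup>2 + ?r))) (at z)"
    using assms by (auto intro!: derivative_eq_intros simp: power2_eq_square field_simps)
  then have hol: "((\<lambda>z. Re (- 1 / z - ?r * z)) has_derivative (\<lambda>v. Re ((1 / z\<^sup>2 - ?r) * v))) (at z)"
    "((\<lambda>z. Re (\<i> * (- 1 / z + ?r * z))) has_derivative (\<lambda>v. Re (\<i> * (1 / z\<^sup>2 + ?r) * v))) (at z)"
    unfolding has_field_derivative_def by (auto dest: has_derivative_Re)
  have "((\<lambda>z. c * ln (cmod z)) has_derivative (\<lambda>v. Re (of_real c / z * v))) (at z)" for c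
  proof -
    have "((\<lambda>z. c * ln (cmod z)) has_derivative (\<lambda>v. c * (sgn z \<bullet> v / cmod z))) (at z)"
      using assms by (auto intro!: derivative_eq_intros has_derivative_cmod simp: divide_inverse)
    moreover have "sgn z \<bullet> v / cmod z = Re (v / z)" for v
      using assms unfolding sgn_div_norm inner_complex_def Re_divide cmod_power2[symmetric]
      by (simp add: field_simps power2_eq_square)
    ultimately show ?thesis by (simp flip: times_divide_eq_right)
  qed
  from this[of "2 * Re a"] this[of "2 * Im a"]
  have "((\<lambda>z. 2 * Re a * ln (cmod z)) has_derivative (\<lambda>v. Re (2 * of_real (Re a) / z * v))) (at z)"
    "((\<lambda>z. 2 * Im a * ln (cmod z)) has_derivative (\<lambda>v. Re (2 * of_real (Im a) / z * v))) (at z)"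
    by (simp_all only: of_real_mult of_real_numeral)
  with hol have "\<forall>i. ((\<lambda>z. surface a z $ i) has_derivative (\<lambda>v. Re (differential a i z * v))) (at z)"
    unfolding forall_4 surface_def differential_def vector_4 by (intro conjI)
  then show ?thesis
    using has_derivative_vec_lambda[of "\<lambda>i z. surface a z $ i"] by (simp only: vec_lambda_eta)
qed

lemma surface_metric:
  assumes "z \<noteq> 0"
  shows "induced_metric (surface a) z v w = (1 / (cmod z)\<^sup>2 + (cmod a)\<^sup>2)\<^sup>2 * (v \<bullet> w)"
  unfolding differential_norm[symmetric]
  by (rule induced_metric_isotropic[where \<psi> = "differential a",
        OF surface_has_derivative[OF assms] differential_isotropic])

lemma differential_nonzero:
  assumes "z \<noteq> 0"
  shows "\<exists>i. differential a i z \<noteq> 0"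
proof (rule ccontr)
  assume "\<not> ?thesis"
  then have "(1 / (cmod z)\<^sup>2 + (cmod a)\<^sup>2)\<^sup>2 = 0"
    using differential_norm[of a z] by simp
  moreover have "1 / (cmod z)\<^sup>2 + (cmod a)\<^sup>2 > 0" using assms by (simp add: add_pos_nonneg)
  ultimately show False by simp
qed

lemma surface_minimal: "minimal_surface (UNIV - {0}) (surface a)"
proof (rule minimal_surface_isotropic)
  show "connected (UNIV - {0::complex})"
    by (intro connected_open_delete) (auto simp: connected_UNIV)
  show "UNIV - {0::complex} \<noteq> {}" using zero_neq_one[where 'a=complex] by blast
  show "(surface a has_derivative (\<lambda>v. \<chi> i. Re (differential a i z * v))) (at z)"
    "(\<Sum>i\<in>UNIV. (differential a i z)\<^sup>2) = 0" "\<exists>i. differential a i z \<noteq> 0"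
    if "z \<in> UNIV - {0}" for z
    using that surface_has_derivative differential_isotropic differential_nonzero by blast+
qed (auto intro: differential_holomorphic)

lemma surface_complete:
  assumes "a \<noteq> 0"
  shows "complete_surface (UNIV - {0}) (surface a)"
proof (rule complete_surface_conformal)
  let ?r = "(cmod a)\<^sup>2"
  let ?\<rho> = "\<lambda>z. 1 / (cmod z)\<^sup>2 + (cmod a)\<^sup>2"
  have r: "?r > 0" using assms by simp
  show "induced_metric (surface a) z v v = (?\<rho> z * norm v)\<^sup>2" if "z \<in> UNIV - {0}" for z v
    using that by (simp add: surface_metric power_mult_distrib power2_norm_eq_inner)
  show "continuous_on (UNIV - {0}) ?\<rho>" by (intro continuous_intros) auto
  show "?\<rho> z \<ge> 0" for z by simp
  show "((\<lambda>z. ?r * cmod z - 1 / cmod z) has_derivative (\<lambda>v. ?\<rho> z * (sgn z \<bullet> v))) (at z)"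
    if "z \<in> UNIV - {0}" for z
    using that
    by (auto intro!: derivative_eq_intros has_derivative_cmod
        simp: fun_eq_iff field_simps power2_eq_square)
  show "\<bar>?\<rho> z * (sgn z \<bullet> v)\<bar> \<le> ?\<rho> z * norm v" if "z \<in> UNIV - {0}" for z v
    using that Cauchy_Schwarz_ineq2[of "sgn z" v]
    by (simp add: abs_mult norm_sgn mult_left_mono)
  \<comment> \<open>A bound on \<open>\<bar>r \<bar>z\<bar> - 1/\<bar>z\<bar>\<bar>\<close> bounds \<open>1/\<bar>z\<bar>\<close> when \<open>\<bar>z\<bar> \<le> 1\<close> and \<open>r \<bar>z\<bar>\<close> when \<open>\<bar>z\<bar> \<ge> 1\<close>, because the
    other term is then at most \<open>r\<close> or \<open>1\<close>. So its sublevel sets lie in closed annuli.\<close>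
  fix n :: real
  let ?n = "max n 0"
  let ?c = "min 1 (1 / (?n + ?r))" and ?C = "max 1 ((?n + 1) / ?r)"
  let ?K = "cball 0 ?C - ball (0::complex) ?c"
  have nr: "?n + ?r > 0" using r by linarith
  have "compact ?K" by (intro compact_diff) auto
  moreover have "?K \<subseteq> UNIV - {0}" using nr by auto
  moreover have "z \<in> ?K" if z: "z \<noteq> 0" "\<bar>?r * cmod z - 1 / cmod z\<bar> \<le> n" for z
  proof -
    have p: "cmod z > 0" using z by simp
    have "cmod z \<le> ?C"
    proof (cases "cmod z \<le> 1")
      case False
      then have "1 / cmod z \<le> 1" by (simp add: divide_le_eq)
      then have "?r * cmod z \<le> ?n + 1" using z by linarith
      then have "cmod z \<le> (?n + 1) / ?r" using r by (simp add: pos_le_divide_eq mult.commute)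
      then show ?thesis by simp
    qed simp
    moreover have "cmod z \<ge> ?c"
    proof (cases "cmod z \<ge> 1")
      case False
      then have "?r * cmod z \<le> ?r" using r by (simp add: mult_left_le)
      then have "1 / cmod z \<le> ?n + ?r" using z by linarith
      then have "1 / (?n + ?r) \<le> cmod z" using p nr by (simp add: field_simps)
      then show ?thesis by simp
    qed simp
    ultimately show ?thesis unfolding Diff_iff mem_cball_0 mem_ball_0 not_less by blast
  qed
  ultimately show "\<exists>K. compact K \<and> K \<subseteq> UNIV - {0} \<and>
      {z \<in> UNIV - {0}. \<bar>?r * cmod z - 1 / cmod z\<bar> \<le> n} \<subseteq> K"
    by (intro exI[of _ ?K]) blast
qed

text \<open>With \<open>\<phi> s = w\<^sup>2\<close> and \<open>w = 1/s + r\<close>, the bracket in the radial formula equals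
  \<open>2 w\<^sup>2 (1/s - w) / s\<^sup>2 = - 2 r w\<^sup>2 / s\<^sup>2\<close>; division by \<open>(\<phi> s)\<^sup>2 = w\<^sup>4\<close> then leaves
  \<open>(s w)\<^sup>2 = (1 + r s)\<^sup>2\<close> in the denominator.\<close>

lemma surface_curvature_form:
  assumes "z \<noteq> 0"
  shows "gauss_curvature (surface a) z * area_density (surface a) z
    = - 4 * (cmod a)\<^sup>2 * inverse ((1 + (cmod a)\<^sup>2 * (cmod z)\<^sup>2)\<^sup>2)"
proof -
  define r where "r = (cmod a)\<^sup>2"
  define \<phi> where "\<phi> s = (1 / s + r)\<^sup>2" for s
  define \<phi>' where "\<phi>' s = - 2 * (1 / s + r) / s\<^sup>2" for s
  define \<phi>'' where "\<phi>'' s = 2 / s ^ 4 + 4 * (1 / s + r) / s ^ 3" for s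
  have D1: "(\<phi> has_real_derivative \<phi>' s) (at s)" if "s \<noteq> 0" for s
    unfolding \<phi>_def[abs_def] \<phi>'_def using that
    by (auto intro!: derivative_eq_intros simp: field_simps power2_eq_square)
  have D2: "(\<phi>' has_real_derivative \<phi>'' s) (at s)" if "s \<noteq> 0" for s
    unfolding \<phi>'_def[abs_def] \<phi>''_def using that
    by (auto intro!: derivative_eq_intros simp: field_simps power2_eq_square power3_eq_cube
        power4_eq_xxxx)
  define s where "s = (cmod z)\<^sup>2"
  have s: "s > 0" and r: "r \<ge> 0" using assms by (simp_all add: s_def r_def)
  have w: "1 / s + r > 0" using s r by (simp add: add_pos_nonneg)
  have "gauss_curvature (surface a) z * area_density (surface a) z
    = 2 * (s * (\<phi>' s)\<^sup>2 - \<phi> s * (\<phi>' s + s * \<phi>'' s)) / (\<phi> s)\<^sup>2"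
  proof -
    have m: "induced_metric (surface a) w v v' = \<phi> ((cmod w)\<^sup>2) * (v \<bullet> v')"
      if "w \<in> UNIV - {0}" for w v v'
      using that by (simp add: surface_metric \<phi>_def r_def)
    have D1': "(\<phi> has_real_derivative \<phi>' ((cmod w)\<^sup>2)) (at ((cmod w)\<^sup>2))"
      if "w \<in> UNIV - {0}" for w
      using that by (intro D1) simp
    have "open (UNIV - {0::complex})" "z \<in> UNIV - {0}" using assms by auto
    from gauss_curvature_radial[OF this, of "surface a" \<phi> \<phi>', OF _ _ _ D1' D2]
    show ?thesis
      using s w by (simp add: metric_E_def metric_F_def metric_G_def m inner_complex_def
        Let_def flip: s_def) (simp add: \<phi>_def)
  qed
  also have "s * (\<phi>' s)\<^sup>2 - \<phi> s * (\<phi>' s + s * \<phi>'' s) = - 2 * r * (1 / s + r)\<^sup>2 / s\<^sup>2"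
  proof -
    define t where "t = 1 / s"
    have t: "s * t = 1" using s by (simp add: t_def)
    have "\<phi> s = (t + r)\<^sup>2" "\<phi>' s = - 2 * (t + r) * t\<^sup>2" "\<phi>'' s = 2 * t ^ 4 + 4 * (t + r) * t ^ 3"
      "- 2 * r * (1 / s + r)\<^sup>2 / s\<^sup>2 = - 2 * r * (t + r)\<^sup>2 * t\<^sup>2"
      by (simp_all add: \<phi>_def \<phi>'_def \<phi>''_def t_def power_divide)
    then show ?thesis using t by algebra
  qed
  also have "2 * \<dots> / (\<phi> s)\<^sup>2 = - 4 * r / (s * (1 / s + r))\<^sup>2"
  proof -
    have "2 * (- 2 * r * w\<^sup>2 / s\<^sup>2) / (w\<^sup>2)\<^sup>2 = - 4 * r / (s * w)\<^sup>2" if "w > 0" for w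
      using s that by (simp add: field_simps power2_eq_square)
    from this[OF w] show ?thesis by (simp only: \<phi>_def)
  qed
  also have "s * (1 / s + r) = 1 + r * s" using s by (simp add: field_simps)
  finally show ?thesis by (simp add: r_def s_def divide_inverse)
qed

lemma surface_finite_total_curvature:
  assumes "a \<noteq> 0"
  shows "finite_total_curvature (UNIV - {0}) (surface a)"
proof -
  have "integrable lborel
      (\<lambda>z. - 4 * (cmod a)\<^sup>2 * inverse ((1 + (cmod a)\<^sup>2 * (cmod z)\<^sup>2)\<^sup>2))"
    using integrable_inverse_1_plus_cmod_square[of "(cmod a)\<^sup>2"] assms
    by (intro integrable_mult_right) simp
  then have "set_integrable lborel (UNIV - {0})
      (\<lambda>z. - 4 * (cmod a)\<^sup>2 * inverse ((1 + (cmod a)\<^sup>2 * (cmod z)\<^sup>2)\<^sup>2))"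
    unfolding set_integrable_def by (rule integrable_mult_indicator[rotated]) simp
  then show ?thesis
    unfolding finite_total_curvature_def
    by (rule iffD1[OF set_integrable_cong, rotated -1]) (auto simp: surface_curvature_form)
qed

text \<open>Off the puncture the defining expression is continuous, so removing singularities does not
  change its values.\<close>

lemma weierstrass_form_eq_differential:
  assumes "z \<noteq> 0"
  shows "weierstrass_form (\<lambda>z. a * z) (\<lambda>z. - cnj a * z) (\<lambda>z. 1 / z\<^sup>2) i z
    = differential a i z / 2"
  unfolding weierstrass_form_def
proof (rule remove_sings_eqI, rule Lim_transform_eventually)
  have "isCont (differential a i) z"
    using differential_holomorphic[of a i] assms
    by (meson Diff_iff UNIV_I continuous_on_eq_continuous_at holomorphic_on_imp_continuous_on
        open_UNIV open_delete singletonD)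
  then show "((\<lambda>w. differential a i w / 2) \<longlongrightarrow> differential a i z / 2) (at z)"
    by (intro tendsto_intros) (simp_all add: isCont_def)
  have re: "2 * of_real (Re a) = a + cnj a" and im: "2 * complex_of_real (Im a) = - \<i> * (a - cnj a)"
    by (simp_all add: complex_eq_iff)
  have "\<forall>i. differential a i w / 2 =
      (vector [1 / 2 * (1 + a * w * (- cnj a * w)) * (1 / w\<^sup>2),
              \<i> / 2 * (1 - a * w * (- cnj a * w)) * (1 / w\<^sup>2),
              1 / 2 * (a * w - (- cnj a * w)) * (1 / w\<^sup>2),
              - (\<i> / 2) * (a * w + (- cnj a * w)) * (1 / w\<^sup>2)] :: complex^4) $ i"
    if "w \<noteq> 0" for w
    using that unfolding forall_4 differential_def vector_4 re im complex_norm_square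
    by (auto simp: field_simps power2_eq_square)
  moreover have "\<forall>\<^sub>F w in at z. w \<noteq> 0"
    by (rule eventually_neq_at_within)
  ultimately show "\<forall>\<^sub>F w in at z. differential a i w / 2 =
      (vector [1 / 2 * (1 + a * w * (- cnj a * w)) * (1 / w\<^sup>2),
              \<i> / 2 * (1 - a * w * (- cnj a * w)) * (1 / w\<^sup>2),
              1 / 2 * (a * w - (- cnj a * w)) * (1 / w\<^sup>2),
              - (\<i> / 2) * (a * w + (- cnj a * w)) * (1 / w\<^sup>2)] :: complex^4) $ i"
    by (auto elim: eventually_mono)
qed

text \<open>For closed paths this is the vanishing of the real periods; for all other paths it is the
  integral representation of the surface.\<close>

lemma Re_contour_integral_differential:
  assumes "valid_path \<gamma>" "path_image \<gamma> \<subseteq> UNIV - {0}"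
  shows "Re (contour_integral \<gamma> (differential a i))
    = surface a (pathfinish \<gamma>) $ i - surface a (pathstart \<gamma>) $ i"
proof -
  let ?r = "complex_of_real ((cmod a)\<^sup>2)"
  have "((\<lambda>z. 1 / z\<^sup>2 - ?r) has_contour_integral
      (- 1 / pathfinish \<gamma> - ?r * pathfinish \<gamma>) - (- 1 / pathstart \<gamma> - ?r * pathstart \<gamma>)) \<gamma>"
    by (rule contour_integral_primitive[OF _ assms])
       (auto intro!: derivative_eq_intros simp: power2_eq_square field_simps)
  note 1 = contour_integral_unique[OF this]
  have "((\<lambda>z. \<i> * (1 / z\<^sup>2 + ?r)) has_contour_integral
      \<i> * (- 1 / pathfinish \<gamma> + ?r * pathfinish \<gamma>)
      - \<i> * (- 1 / pathstart \<gamma> + ?r * pathstart \<gamma>)) \<gamma>"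
    by (rule contour_integral_primitive[OF _ assms])
       (auto intro!: derivative_eq_intros simp: power2_eq_square field_simps)
  note 2 = contour_integral_unique[OF this]
  have "(\<lambda>w. 1 / w) contour_integrable_on \<gamma>"
    using assms by (intro contour_integrable_holomorphic_simple[of _ "UNIV - {0}"])
      (auto intro!: holomorphic_intros)
  then have "contour_integral \<gamma> (\<lambda>w. of_real c * (1 / w)) = of_real c * contour_integral \<gamma> (\<lambda>w. 1 / w)"
    for c by (rule contour_integral_lmul)
  then have 3: "Re (contour_integral \<gamma> (\<lambda>w. of_real c / w))
      = c * (ln (cmod (pathfinish \<gamma>)) - ln (cmod (pathstart \<gamma>)))" for c
    using Re_contour_integral_inverse[OF assms(1)] assms(2) by auto
  have "\<forall>i. Re (contour_integral \<gamma> (\<lambda>z. differential a i z))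
    = surface a (pathfinish \<gamma>) $ i - surface a (pathstart \<gamma>) $ i"
    unfolding forall_4 differential_def surface_def vector_4 1 2
    using 3[of "2 * Re a"] 3[of "2 * Im a"] by (simp add: algebra_simps)
  then show ?thesis by simp
qed

lemma surface_weierstrass_data:
  "weierstrass_data (UNIV - {0}) (\<lambda>z. a * z) (\<lambda>z. - cnj a * z) (\<lambda>z. 1 / z\<^sup>2) (surface a)"
proof -
  define w where "w = weierstrass_form (\<lambda>z. a * z) (\<lambda>z. - cnj a * z) (\<lambda>z. 1 / z\<^sup>2)"
  have w: "w i z = differential a i z / 2" if "z \<noteq> 0" for i z
    unfolding w_def by (rule weierstrass_form_eq_differential[OF that])
  have int: "contour_integral \<gamma> (w i) = contour_integral \<gamma> (differential a i) / 2"
    "contour_integral \<gamma> (\<lambda>z. 2 * w i z) = contour_integral \<gamma> (differential a i)"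
    if "valid_path \<gamma>" "path_image \<gamma> \<subseteq> UNIV - {0}" for \<gamma> i
  proof -
    have nz: "z \<noteq> 0" if "z \<in> path_image \<gamma>" for z
      using \<open>path_image \<gamma> \<subseteq> UNIV - {0}\<close> that by blast
    have "differential a i contour_integrable_on \<gamma>"
      using that differential_holomorphic
      by (intro contour_integrable_holomorphic_simple[of _ "UNIV - {0}"]) auto
    then have "contour_integral \<gamma> (\<lambda>z. differential a i z / 2) = contour_integral \<gamma> (differential a i) / 2"
      by (rule contour_integral_div)
    moreover have "contour_integral \<gamma> (w i) = contour_integral \<gamma> (\<lambda>z. differential a i z / 2)"
      by (intro contour_integral_eq) (simp add: w nz)
    ultimately show "contour_integral \<gamma> (w i) = contour_integral \<gamma> (differential a i) / 2" by simp
    show "contour_integral \<gamma> (\<lambda>z. 2 * w i z) = contour_integral \<gamma> (differential a i)"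
      by (intro contour_integral_eq) (simp add: w nz)
  qed
  have "w i holomorphic_on UNIV - {0}" for i
    by (rule holomorphic_transform[of "\<lambda>z. differential a i z / 2"])
       (auto intro!: holomorphic_intros differential_holomorphic simp: w)
  moreover have "\<exists>i. w i z \<noteq> 0" if "z \<in> UNIV - {0}" for z
    using differential_nonzero[of z a] that by (simp add: w)
  moreover have "Re (contour_integral c (w i)) = 0"
    if "valid_path c" "path_image c \<subseteq> UNIV - {0}" "pathfinish c = pathstart c" for c i
    using Re_contour_integral_differential[OF that(1,2), of a i] that by (simp add: int)
  moreover have "(1 :: complex) \<in> UNIV - {0}" by simp
  moreover have "surface a z = surface a 1
      + (\<chi> i. Re (contour_integral \<gamma> (\<lambda>z. 2 * w i z)))"
    if "valid_path \<gamma>" "path_image \<gamma> \<subseteq> UNIV - {0}" "pathstart \<gamma> = 1" "pathfinish \<gamma> = z" for z \<gamma>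
    using Re_contour_integral_differential[OF that(1,2), of a] that by (simp add: int vec_eq_iff)
  moreover have "(\<lambda>z. a * z) meromorphic_on UNIV - {0}" "(\<lambda>z. - cnj a * z) meromorphic_on UNIV - {0}"
    by (auto intro!: analytic_on_imp_meromorphic_on analytic_intros)
  moreover have "(\<lambda>z::complex. 1 / z\<^sup>2) holomorphic_on UNIV - {0}"
    by (auto intro!: holomorphic_intros)
  ultimately show ?thesis
    unfolding weierstrass_data_def w_def[symmetric]
    by (intro conjI allI ballI impI bexI[of _ 1] exI[of _ "surface a 1"]) blast+
qed

theorem theorem4p13:
  fixes a :: complex
  defines "\<Sigma> \<equiv> UNIV - {0 :: complex}"
    and "g1 \<equiv> \<lambda>z::complex. a * z"
    and "g2 \<equiv> \<lambda>z::complex. - cnj a * z"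
    and "h \<equiv> \<lambda>z::complex. 1 / z\<^sup>2"
  assumes "a \<noteq> 0"
  shows "(\<exists>X :: complex \<Rightarrow> real^4.
            minimal_surface \<Sigma> X \<and> complete_surface \<Sigma> X \<and>
            weierstrass_data \<Sigma> g1 g2 h X \<and>
            finite_total_curvature \<Sigma> X)
         \<and> omits \<Sigma> g1 (Sphere_of 0) \<and> omits \<Sigma> g1 Sphere_infty
         \<and> omits \<Sigma> g2 (Sphere_of 0) \<and> omits \<Sigma> g2 Sphere_infty"
proof -
  have "open \<Sigma>" "g1 holomorphic_on \<Sigma>" "g2 holomorphic_on \<Sigma>"
    unfolding \<Sigma>_def g1_def g2_def by (auto intro!: holomorphic_intros)
  moreover have "g1 z \<noteq> 0" "g2 z \<noteq> 0" if "z \<in> \<Sigma>" for z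
    using that \<open>a \<noteq> 0\<close> by (auto simp: \<Sigma>_def g1_def g2_def)
  moreover have "minimal_surface \<Sigma> (surface a)" "complete_surface \<Sigma> (surface a)"
    "weierstrass_data \<Sigma> g1 g2 h (surface a)" "finite_total_curvature \<Sigma> (surface a)"
    unfolding \<Sigma>_def g1_def g2_def h_def
    using surface_minimal surface_complete surface_weierstrass_data surface_finite_total_curvature
      \<open>a \<noteq> 0\<close> by blast+
  ultimately show ?thesis
    using omits_holomorphic by meson
qed

end
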